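(* We have $$9 \leq \tilde{m}_2(4) \leq 10 \qquad\text{and}\qquad 16 \leq \tilde{m}_2(5) \leq 17.$$
   Context: A hypergraph $\mathcal{H}$ on a set $X$ (of vertices) is a collection of subsets of $X$, called edges; it is $r$-uniform if every edge has exactly $r$ elements. $|\mathcal{H}|$ is the number of edges. Each nonnegative integer $k$ is identified with the set $\{0,\dots,k-1\}$. Functions are identified with their graphs, so $\subseteq$, $\cap$ may be applied to functions. $[X \rightharpoonup k]$ denotes the set of all partial maps from $X$ to $k$, i.e. functions $\varphi$ defined on a subset $\mathrm{dom}(\varphi)$ of $X$ with values in $k$. For $\mathcal{F} \subseteq [X \rightharpoonup k]$, $\mathrm{dom}(\mathcal{F}) := \{\mathrm{dom}(\varphi) : \varphi \in \mathcal{F}\}$. An $\mathcal{F}$-coloring is a (total) function $f \colon X \to k$ such that $\varphi \not\subseteq f$ for all $\varphi \in \mathcal{F}$. A $k$-fold cover of a hypergraph $\mathcal{H}$ on $X$ is a family $\mathcal{F} \subseteq [X \rightharpoonup k]$ such that $\mathrm{dom}(\mathcal{F}) \subseteq \mathcal{H}$ and, whenever $\varphi, \psi \in \mathcal{F}$ are distinct with $\mathrm{dom}(\varphi) = \mathrm{dom}(\psi)$, we have $\varphi \cap \psi = \varnothing$ (i.e. $\varphi(x)\neq\psi(x)$ for every $x$ in the common domain). A hypergraph $\mathcal{H}$ is $k$-DP-colorable if every $k$-fold cover $\mathcal{F}$ of $\mathcal{H}$ admits an $\mathcal{F}$-coloring. For integers $r,k\ge 1$, $\tilde{m}_k(r)$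 denotes the minimum $|\mathcal{H}|$ over all $r$-uniform hypergraphs $\mathcal{H}$ that are not $k$-DP-colorable. *)

theory Defs imports Main begin

text \<open>
  A hypergraph on a vertex set \<open>X\<close> is given by \<open>X\<close> together with its set of edges.
  A natural number \<open>k\<close> is identified with \<open>{..<k}\<close>. Partial functions are values of type
  \<open>'v \<rightharpoonup> nat\<close>; inclusion of functions regarded as graphs is \<open>(\<subseteq>\<^sub>m)\<close>. A total function on \<open>X\<close>
  is a partial function with domain exactly \<open>X\<close>.
\<close>

definition hypergraph :: "'v set \<Rightarrow> 'v set set \<Rightarrow> bool" where
  "hypergraph X H \<longleftrightarrow> H \<subseteq> Pow X"

definition uniform :: "nat \<Rightarrow> 'v set set \<Rightarrow> bool" where
  "uniform r H \<longleftrightarrow> (\<forall>e\<in>H. finite e \<and> card e = r)"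

definition partial_maps :: "'v set \<Rightarrow> nat \<Rightarrow> ('v \<rightharpoonup> nat) set" where
  "partial_maps X k = {\<phi>. dom \<phi> \<subseteq> X \<and> ran \<phi> \<subseteq> {..<k}}"

definition total_maps :: "'v set \<Rightarrow> nat \<Rightarrow> ('v \<rightharpoonup> nat) set" where
  "total_maps X k = {f. dom f = X \<and> ran f \<subseteq> {..<k}}"

definition family_coloring ::
  "'v set \<Rightarrow> nat \<Rightarrow> ('v \<rightharpoonup> nat) set \<Rightarrow> ('v \<rightharpoonup> nat) \<Rightarrow> bool" where
  "family_coloring X k F f \<longleftrightarrow> f \<in> total_maps X k \<and> (\<forall>\<phi>\<in>F. \<not> \<phi> \<subseteq>\<^sub>m f)"

definition fold_cover ::
  "nat \<Rightarrow> 'v set \<Rightarrow> 'v set set \<Rightarrow> ('v \<rightharpoonup> nat) set \<Rightarrow> bool" where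
  "fold_cover k X H F \<longleftrightarrow>
     F \<subseteq> partial_maps X k \<and> dom ` F \<subseteq> H \<and>
     (\<forall>\<phi>\<in>F. \<forall>\<psi>\<in>F. \<phi> \<noteq> \<psi> \<longrightarrow> dom \<phi> = dom \<psi> \<longrightarrow> Map.graph \<phi> \<inter> Map.graph \<psi> = {})"

definition DP_colorable :: "nat \<Rightarrow> 'v set \<Rightarrow> 'v set set \<Rightarrow> bool" where
  "DP_colorable k X H \<longleftrightarrow> (\<forall>F. fold_cover k X H F \<longrightarrow> (\<exists>f. family_coloring X k F f))"

text \<open>
  The minimum is taken over hypergraphs with vertices in \<open>nat\<close>; lemma \<open>m_tilde_le\<close> below shows
  that hypergraphs over any other vertex type give nothing smaller. Finiteness of \<open>H\<close> is required
  because \<open>card\<close> is 0 on infinite sets. Note that \<open>Inf {} = 0\<close> on \<open>nat\<close>, so a positive lower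
  bound on \<open>m_tilde\<close> entails that the minimum exists.
\<close>

definition m_tilde :: "nat \<Rightarrow> nat \<Rightarrow> nat" where
  "m_tilde k r = Inf {card H | (X :: nat set) H.
     hypergraph X H \<and> finite H \<and> uniform r H \<and> \<not> DP_colorable k X H}"

lemma m_tilde_le:
  fixes X :: "'v set"
  assumes k: "k \<ge> 1" and H: "hypergraph X H" "finite H" "uniform r H"
    and nc: "\<not> DP_colorable k X H"
  shows "m_tilde k r \<le> card H"
proof -
  define V where "V = \<Union>H"
  have VX: "V \<subseteq> X" and eV: "\<And>e. e \<in> H \<Longrightarrow> e \<subseteq> V"
    using H(1) by (auto simp: V_def hypergraph_def)
  have "finite V" using H(2,3) by (auto simp: V_def uniform_def)
  then obtain g :: "'v \<Rightarrow> nat" where g: "inj_on g V"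
    using finite_imp_inj_to_nat_seg by blast
  define H' where "H' = (`) g ` H"
  have "inj_on ((`) g) H"
    using inj_on_image_Pow[OF g] eV by (meson PowI inj_on_subset subsetI)
  then have card: "card H' = card H" by (simp add: H'_def card_image)
  have hyp: "hypergraph (g ` V) H'" using eV by (auto simp: hypergraph_def H'_def)
  have fin: "finite H'" using H(2) by (simp add: H'_def)
  have unif: "uniform r H'"
    using H(3) eV g unfolding uniform_def H'_def by (auto simp: card_image inj_on_subset)
  obtain F where F: "fold_cover k X H F" and nF: "\<And>f. \<not> family_coloring X k F f"
    using nc by (auto simp: DP_colorable_def)
  have domV: "dom \<phi> \<subseteq> V" if "\<phi> \<in> F" for \<phi>
    using F that eV by (auto simp: fold_cover_def)
  define T where "T \<phi> = (\<lambda>n. if n \<in> g ` V then \<phi> (inv_into V g n) else None)"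
    for \<phi> :: "'v \<rightharpoonup> nat"
  have Tg: "T \<phi> (g v) = \<phi> v" if "v \<in> V" for \<phi> v
    using that g by (simp add: T_def)
  have TN: "T \<phi> n = None" if "n \<notin> g ` V" for \<phi> n
    using that by (simp add: T_def)
  have domT: "dom (T \<phi>) = g ` dom \<phi>" if "\<phi> \<in> F" for \<phi>
  proof
    show "dom (T \<phi>) \<subseteq> g ` dom \<phi>"
    proof
      fix n assume n: "n \<in> dom (T \<phi>)"
      then obtain v where v: "v \<in> V" "n = g v" using TN[of n \<phi>] by (cases "n \<in> g ` V") auto
      then show "n \<in> g ` dom \<phi>" using n Tg[of v \<phi>] by (metis domIff imageI)
    qed
    show "g ` dom \<phi> \<subseteq> dom (T \<phi>)" using domV[OF that] Tg by (force simp: dom_def)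
  qed
  have ranT: "ran (T \<phi>) \<subseteq> ran \<phi>" for \<phi>
    by (auto simp: ran_def T_def split: if_splits)
  have "fold_cover k (g ` V) H' (T ` F)"
    unfolding fold_cover_def
  proof (intro conjI ballI impI)
    have "ran (T \<phi>) \<subseteq> {..<k}" if "\<phi> \<in> F" for \<phi>
      using ranT[of \<phi>] F that by (fastforce simp: fold_cover_def partial_maps_def)
    then show "T ` F \<subseteq> partial_maps (g ` V) k"
      using domT domV by (fastforce simp: partial_maps_def)
    show "dom ` T ` F \<subseteq> H'"
      using F domT by (fastforce simp: fold_cover_def H'_def image_subset_iff)
    fix \<phi>' \<psi>' assume "\<phi>' \<in> T ` F" "\<psi>' \<in> T ` F" and ne: "\<phi>' \<noteq> \<psi>'" and d: "dom \<phi>' = dom \<psi>'"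
    then obtain \<phi> \<psi> where *: "\<phi> \<in> F" "\<phi>' = T \<phi>" "\<psi> \<in> F" "\<psi>' = T \<psi>" by auto
    have "g ` dom \<phi> = g ` dom \<psi>" using d * domT by simp
    then have "dom \<phi> = dom \<psi>"
      by (simp only: inj_on_image_eq_iff[OF g domV[OF *(1)] domV[OF *(3)]])
    moreover have "\<phi> \<noteq> \<psi>" using ne *(2,4) by blast
    moreover have "\<forall>\<phi>\<in>F. \<forall>\<psi>\<in>F. \<phi> \<noteq> \<psi> \<longrightarrow> dom \<phi> = dom \<psi> \<longrightarrow> Map.graph \<phi> \<inter> Map.graph \<psi> = {}"
      using F unfolding fold_cover_def by (elim conjE)
    ultimately have disj: "Map.graph \<phi> \<inter> Map.graph \<psi> = {}"
      using *(1,3) by simp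
    show "Map.graph \<phi>' \<inter> Map.graph \<psi>' = {}"
    proof (rule ccontr)
      assume "Map.graph \<phi>' \<inter> Map.graph \<psi>' \<noteq> {}"
      then obtain n c where n: "T \<phi> n = Some c" "T \<psi> n = Some c"
        unfolding *(2,4) by (auto simp: Map.graph_def)
      then obtain v where "v \<in> V" "n = g v" using TN[of n \<phi>] by (cases "n \<in> g ` V") auto
      then have "\<phi> v = Some c" "\<psi> v = Some c" using n Tg by metis+
      then show False using disj by (auto simp: Map.graph_def)
    qed
  qed
  moreover have "\<not> family_coloring (g ` V) k (T ` F) f'" for f'
  proof
    assume f': "family_coloring (g ` V) k (T ` F) f'"
    define f where "f = (\<lambda>x. if x \<in> V then f' (g x) else if x \<in> X then Some 0 else None)"
    have df': "dom f' = g ` V" and rf': "ran f' \<subseteq> {..<k}"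
      using f' by (auto simp: family_coloring_def total_maps_def)
    have "dom f = X"
      using df' VX by (auto simp: f_def dom_def split: if_splits)
    moreover have "ran f \<subseteq> {..<k}"
      using rf' k by (auto simp: f_def ran_def split: if_splits)
    moreover have "\<not> \<phi> \<subseteq>\<^sub>m f" if "\<phi> \<in> F" for \<phi>
    proof
      assume le: "\<phi> \<subseteq>\<^sub>m f"
      have "T \<phi> \<subseteq>\<^sub>m f'"
        unfolding map_le_def
      proof
        fix n assume "n \<in> dom (T \<phi>)"
        then obtain v where v: "v \<in> dom \<phi>" "n = g v" using domT[OF \<open>\<phi> \<in> F\<close>] by auto
        then have "v \<in> V" using domV[OF \<open>\<phi> \<in> F\<close>] by auto
        then show "T \<phi> n = f' n" using le v Tg by (auto simp: map_le_def f_def)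
      qed
      then show False using f' that by (auto simp: family_coloring_def)
    qed
    ultimately have "family_coloring X k F f"
      by (auto simp: family_coloring_def total_maps_def)
    then show False using nF by blast
  qed
  ultimately have nc': "\<not> DP_colorable k (g ` V) H'" unfolding DP_colorable_def by blast
  have "card H \<in> {card H | (X :: nat set) H.
     hypergraph X H \<and> finite H \<and> uniform r H \<and> \<not> DP_colorable k X H}"
  proof (intro CollectI exI conjI)
    show "card H = card H'" using card by (rule sym)
    show "hypergraph (g ` V) H'" by (rule hyp)
  qed (rule fin unif nc')+
  then show ?thesis unfolding m_tilde_def by (rule cInf_lower) simp
qed

end

theory Submission imports Defs "HOL-Library.FuncSet" begin

text \<open>
  Suppose that a \<open>k\<close>-fold cover of an \<open>r\<close>-uniform hypergraph with \<open>n\<close> vertices admits no colouring.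
  Then every one of the \<open>k^n\<close> maps to \<open>k\<close> extends a member of the cover. One member is extended by
  \<open>k^(n-r)\<close> maps, and an edge carries at most \<open>k\<close> members because they disagree at each of its
  vertices; so there are at least \<open>k^(r-1)\<close> edges (\<open>card_edges_ge\<close>). This gives the lower bound 16
  for five-element edges, but only 8 for four-element ones.
  
  To exclude equality for \<open>k = 2\<close> and even \<open>r\<close> (\<open>card_edges_gt\<close>), note that equality forces the
  members to partition the colourings. Weigh each colouring \<open>f\<close> by the character
  \<open>(-1)^(\<Sum>v\<in>e. f v)\<close> of an edge \<open>e\<close> that carries a member. The total weight is 0. A member on
  another edge contributes 0, since it leaves some vertex of \<open>e\<close> free. A member on \<open>e\<close> itself
  contributes a nonzero amount, and the at most two such members are antipodal, hence for even \<open>r\<close>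
  contribute with the same sign. So the total is nonzero, a contradiction. For odd \<open>r\<close> the two
  contributions can cancel, and the argument says nothing.
  
  The upper bounds come from explicit covers with 10 and 17 edges. For two colours a cover amounts
  to one 0-1 pattern on each edge, which is forbidden together with its complement;
  \<open>pattern_system_uncolorable\<close> reduces uncolourability to a finite check, carried out for
  \<open>patterns4\<close> and \<open>patterns5\<close>. These covers also show that uncolourable hypergraphs exist, so that the
  minimum is attained and the lower bounds apply to it.
\<close>

section \<open>Double counting for an uncolourable cover\<close>

locale uncolorable_cover =
  fixes k r :: nat and X :: "'v set" and H :: "'v set set" and F :: "('v \<rightharpoonup> nat) set"
  assumes k_pos: "k \<ge> 1" and r_pos: "r \<ge> 1"
    and fin_H: "finite H" and hyp: "hypergraph X H" and unif: "uniform r H"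
    and cover: "fold_cover k X H F" and uncolorable: "\<And>f. \<not> family_coloring X k F f"
begin

text \<open>
  Vertices outside all edges are irrelevant to colourability, and \<open>X\<close> may be infinite; counting is
  therefore done over the finite set of covered vertices.
\<close>

definition V :: "'v set" where "V = \<Union>H"

definition colorings :: "('v \<Rightarrow> nat) set" where
  "colorings = V \<rightarrow>\<^sub>E {..<k}"

definition cylinder :: "('v \<rightharpoonup> nat) \<Rightarrow> ('v \<Rightarrow> nat) set" where
  "cylinder \<phi> = (\<Pi>\<^sub>E v\<in>V. if v \<in> dom \<phi> then {the (\<phi> v)} else {..<k})"

lemma fin_V: "finite V"
  using fin_H unif by (auto simp: V_def uniform_def)

lemma fin_colorings: "finite colorings"
  unfolding colorings_def by (intro finite_PiE) (auto simp: fin_V)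

lemma dom_edge: "\<phi> \<in> F \<Longrightarrow> dom \<phi> \<in> H"
  using cover by (auto simp: fold_cover_def)

lemma dom_subset_V: "\<phi> \<in> F \<Longrightarrow> dom \<phi> \<subseteq> V"
  using dom_edge by (auto simp: V_def)

lemma edge_card: "e \<in> H \<Longrightarrow> finite e \<and> card e = r"
  using unif by (auto simp: uniform_def)

lemma value_less: "\<phi> \<in> F \<Longrightarrow> v \<in> dom \<phi> \<Longrightarrow> the (\<phi> v) < k"
  using cover by (fastforce simp: fold_cover_def partial_maps_def ran_def)

lemma values_differ:
  assumes "\<phi> \<in> F" "\<psi> \<in> F" "\<phi> \<noteq> \<psi>" "dom \<phi> = dom \<psi>" "v \<in> dom \<phi>"
  shows "the (\<phi> v) \<noteq> the (\<psi> v)"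
proof
  assume eq: "the (\<phi> v) = the (\<psi> v)"
  obtain a where a: "\<phi> v = Some a" using assms(5) by blast
  obtain b where b: "\<psi> v = Some b" using assms(4,5) by blast
  have "(v, a) \<in> Map.graph \<phi> \<inter> Map.graph \<psi>"
    using a b eq by (simp add: Map.graph_def)
  then show False using cover assms(1-4) unfolding fold_cover_def by (metis empty_iff)
qed

lemma cylinder_subset: "\<phi> \<in> F \<Longrightarrow> cylinder \<phi> \<subseteq> colorings"
  unfolding cylinder_def colorings_def by (intro PiE_mono) (auto dest: value_less)

lemma covered:
  assumes "f \<in> colorings"
  shows "\<exists>\<phi>\<in>F. f \<in> cylinder \<phi>"
proof -
  define g where "g v = (if v \<in> V then Some (f v) else if v \<in> X then Some 0 else None)" for v
  have VX: "V \<subseteq> X" using hyp by (auto simp: V_def hypergraph_def)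
  have "f v < k" if "v \<in> V" for v
    using assms that by (auto simp: colorings_def PiE_def Pi_def)
  then have "g \<in> total_maps X k"
    using k_pos VX by (auto simp: total_maps_def g_def dom_def ran_def split: if_splits)
  then obtain \<phi> where \<phi>: "\<phi> \<in> F" "\<phi> \<subseteq>\<^sub>m g"
    using uncolorable[of g] by (auto simp: family_coloring_def)
  have "f v = the (\<phi> v)" if "v \<in> dom \<phi>" for v
    using \<phi>(2) that dom_subset_V[OF \<phi>(1)] by (auto simp: map_le_def g_def)
  then have "f \<in> cylinder \<phi>"
    using assms by (auto simp: cylinder_def colorings_def PiE_def Pi_def)
  then show ?thesis using \<phi>(1) by blast
qed

lemma F_nonempty: "F \<noteq> {}"
proof -
  have "(\<lambda>v\<in>V. 0) \<in> colorings" using k_pos by (auto simp: colorings_def)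
  then show ?thesis using covered by blast
qed

lemma r_le_card_V: "r \<le> card V"
proof -
  obtain \<phi> where "\<phi> \<in> F" using F_nonempty by blast
  then show ?thesis
    using card_mono[OF fin_V dom_subset_V] edge_card[OF dom_edge] by metis
qed

lemma card_colorings: "card colorings = k ^ r * k ^ (card V - r)"
  using r_le_card_V by (simp add: colorings_def card_PiE fin_V flip: power_add)

lemma card_cylinder:
  assumes "\<phi> \<in> F"
  shows "card (cylinder \<phi>) = k ^ (card V - r)"
proof -
  note d = dom_subset_V[OF assms] edge_card[OF dom_edge[OF assms]]
  have "card (cylinder \<phi>) = (\<Prod>v\<in>V. if v \<in> dom \<phi> then 1 else k)"
    unfolding cylinder_def by (subst card_PiE[OF fin_V]) (auto intro: prod.cong)
  also have "\<dots> = k ^ card (V - dom \<phi>)"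
    by (simp add: prod.If_cases fin_V Diff_eq)
  also have "card (V - dom \<phi>) = card V - r"
    using d by (simp add: card_Diff_subset)
  finally show ?thesis .
qed

text \<open>
  Members with the same domain differ at every vertex of it, so a member is determined by its domain
  and its value at a single chosen vertex there.
\<close>

lemma family_finite_card: "finite F \<and> card F \<le> k * card H"
proof -
  define pick where "pick e = (SOME v. v \<in> e)" for e :: "'v set"
  define tag where "tag \<phi> = (dom \<phi>, the (\<phi> (pick (dom \<phi>))))" for \<phi> :: "'v \<rightharpoonup> nat"
  have pick: "pick (dom \<phi>) \<in> dom \<phi>" if "\<phi> \<in> F" for \<phi>
  proof -
    have "dom \<phi> \<noteq> {}" using edge_card[OF dom_edge[OF that]] r_pos by force
    then show ?thesis unfolding pick_def by (meson ex_in_conv someI_ex)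
  qed
  have "inj_on tag F"
  proof (rule inj_onI, rule ccontr)
    fix \<phi> \<psi> assume *: "\<phi> \<in> F" "\<psi> \<in> F" "tag \<phi> = tag \<psi>" "\<phi> \<noteq> \<psi>"
    then have "dom \<phi> = dom \<psi>" by (simp add: tag_def)
    then show False using values_differ[OF *(1,2,4) _ pick[OF *(1)]] *(3) by (simp add: tag_def)
  qed
  moreover have sub: "tag ` F \<subseteq> H \<times> {..<k}"
    using dom_edge value_less pick by (auto simp: tag_def)
  moreover have "card (H \<times> {..<k}) = k * card H" by (simp add: card_cartesian_product)
  ultimately show ?thesis
    using card_inj_on_le[of tag F "H \<times> {..<k}"] finite_imageD[of tag F] fin_H
    by (metis finite_SigmaI finite_lessThan finite_subset)
qed

lemma fin_F: "finite F" and card_F: "card F \<le> k * card H"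
  using family_finite_card by auto

definition hits :: "('v \<Rightarrow> nat) \<Rightarrow> nat" where
  "hits f = card {\<phi>\<in>F. f \<in> cylinder \<phi>}"

lemma hits_pos: "f \<in> colorings \<Longrightarrow> 1 \<le> hits f"
  using covered[of f] fin_F by (auto simp: hits_def Suc_le_eq card_gt_0_iff)

text \<open>
  The weight 1 gives the lower bound for all \<open>k\<close> and \<open>r\<close>; a character as weight detects that the
  cylinders cannot partition the colourings when \<open>r\<close> is even.
\<close>

lemma weighted_double_count:
  fixes w :: "('v \<Rightarrow> nat) \<Rightarrow> int"
  shows "(\<Sum>f\<in>colorings. w f * int (hits f)) = (\<Sum>\<phi>\<in>F. \<Sum>f\<in>cylinder \<phi>. w f)"
proof -
  have "(\<Sum>f\<in>colorings. w f * int (hits f))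
      = (\<Sum>f\<in>colorings. \<Sum>\<phi>\<in>F. if f \<in> cylinder \<phi> then w f else 0)"
    by (simp add: hits_def sum.If_cases[OF fin_F] Collect_conj_eq mult.commute)
  also have "\<dots> = (\<Sum>\<phi>\<in>F. \<Sum>f\<in>colorings. if f \<in> cylinder \<phi> then w f else 0)"
    by (rule sum.swap)
  also have "\<dots> = (\<Sum>\<phi>\<in>F. \<Sum>f\<in>cylinder \<phi>. w f)"
  proof (rule sum.cong[OF refl])
    fix \<phi> assume "\<phi> \<in> F"
    then have "{f \<in> colorings. f \<in> cylinder \<phi>} = cylinder \<phi>"
      using cylinder_subset by blast
    then show "(\<Sum>f\<in>colorings. if f \<in> cylinder \<phi> then w f else 0) = (\<Sum>f\<in>cylinder \<phi>. w f)"
      using sum.inter_filter[OF fin_colorings, of w "\<lambda>f. f \<in> cylinder \<phi>"] by simp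
  qed
  finally show ?thesis .
qed

lemma sum_hits: "(\<Sum>f\<in>colorings. hits f) = card F * k ^ (card V - r)"
proof -
  have "int (\<Sum>f\<in>colorings. hits f) = int (card F * k ^ (card V - r))"
    using weighted_double_count[of "\<lambda>_. 1"] by (simp add: card_cylinder)
  then show ?thesis by linarith
qed

lemma sum_hits_ge: "card colorings \<le> (\<Sum>f\<in>colorings. hits f)"
  using sum_mono[of colorings "\<lambda>_. 1" hits] hits_pos by simp

lemma sum_hits_le: "(\<Sum>f\<in>colorings. hits f) \<le> k * card H * k ^ (card V - r)"
  using card_F by (simp add: sum_hits)

lemma card_edges_ge: "k ^ (r - 1) \<le> card H"
proof -
  have "k ^ r * k ^ (card V - r) \<le> k * card H * k ^ (card V - r)"
    using order_trans[OF sum_hits_ge sum_hits_le] by (simp only: card_colorings)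
  then have "k ^ r \<le> k * card H" using k_pos by simp
  moreover have "k ^ r = k * k ^ (r - 1)" using r_pos by (cases r) auto
  ultimately show ?thesis using k_pos by simp
qed

end

section \<open>Two colours and even uniformity\<close>

locale even_uncolorable_cover = uncolorable_cover 2 r X H F
  for r :: nat and X :: "'v set" and H F +
  assumes even_r: "even r"
begin

definition parity :: "'v set \<Rightarrow> ('v \<Rightarrow> nat) \<Rightarrow> int" where
  "parity e f = (\<Prod>v\<in>e. (-1) ^ f v)"

text \<open>
  The sum factorises over the vertices, and a free vertex of \<open>e\<close> contributes the factor \<open>1 - 1\<close>.
\<close>

lemma parity_sum_vanishes:
  assumes "v \<in> V" "v \<in> e" "e \<subseteq> V" "B v = {..<2}" "\<And>v. v \<in> V \<Longrightarrow> finite (B v)"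
  shows "(\<Sum>f\<in>PiE V B. parity e f) = 0"
proof -
  have "V \<inter> e = e" using assms(3) by blast
  then have "parity e f = (\<Prod>v\<in>V. if v \<in> e then (-1) ^ f v else 1)" for f
    by (simp add: parity_def prod.If_cases fin_V)
  then have "(\<Sum>f\<in>PiE V B. parity e f)
      = (\<Sum>f\<in>PiE V B. \<Prod>v\<in>V. if v \<in> e then (-1) ^ f v else 1)" by (intro sum.cong refl)
  also have "\<dots> = (\<Prod>v\<in>V. \<Sum>c\<in>B v. if v \<in> e then (-1) ^ c else 1)"
    using prod_sum_PiE[OF fin_V assms(5)] by (rule sym)
  also have "\<dots> = 0"
  proof (rule prod_zero[OF fin_V], rule bexI[OF _ assms(1)])
    show "(\<Sum>c\<in>B v. if v \<in> e then (-1 :: int) ^ c else 1) = 0"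
      using assms(2,4) by (simp add: numeral_2_eq_2)
  qed
  finally show ?thesis .
qed

text \<open>
  All edges have the same size, so a member on an edge other than \<open>e\<close> leaves a vertex of \<open>e\<close> free.
\<close>

lemma parity_sum_cylinder:
  assumes "e \<in> H" "\<phi> \<in> F"
  shows "(\<Sum>f\<in>cylinder \<phi>. parity e f)
       = (if dom \<phi> = e then parity e (\<lambda>v. the (\<phi> v)) * 2 ^ (card V - r) else 0)"
proof (cases "dom \<phi> = e")
  case True
  have "parity e f = parity e (\<lambda>v. the (\<phi> v))" if "f \<in> cylinder \<phi>" for f
    unfolding parity_def
  proof (rule prod.cong[OF refl])
    fix v assume "v \<in> e"
    then have v: "v \<in> V" "v \<in> dom \<phi>" using True dom_subset_V[OF assms(2)] by auto
    then have "f v = the (\<phi> v)"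
      using PiE_mem[OF that[unfolded cylinder_def] v(1)] by (simp only: if_True singleton_iff)
    then show "(-1) ^ f v = (-1 :: int) ^ the (\<phi> v)" by simp
  qed
  then show ?thesis using True card_cylinder[OF assms(2)] by simp
next
  case False
  have "\<not> e \<subseteq> dom \<phi>"
    using False card_subset_eq[of "dom \<phi>" e] edge_card[OF assms(1)]
      edge_card[OF dom_edge[OF assms(2)]] by auto
  then obtain v where "v \<in> e" "v \<notin> dom \<phi>" by blast
  moreover have "e \<subseteq> V" using assms(1) by (auto simp: V_def)
  ultimately show ?thesis
    using False unfolding cylinder_def by (subst parity_sum_vanishes[of v]) auto
qed

text \<open>
  Two members on one edge are complementary, so passing from one to the other changes \<open>r\<close> signs.
\<close>

lemma parity_of_antipode:
  assumes "\<phi> \<in> F" "\<psi> \<in> F" "dom \<psi> = dom \<phi>"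
  shows "parity (dom \<phi>) (\<lambda>v. the (\<psi> v)) = parity (dom \<phi>) (\<lambda>v. the (\<phi> v))"
proof (cases "\<psi> = \<phi>")
  case False
  have "parity (dom \<phi>) (\<lambda>v. the (\<psi> v)) = (\<Prod>v\<in>dom \<phi>. - ((-1) ^ the (\<phi> v)))"
    unfolding parity_def
  proof (rule prod.cong[OF refl])
    fix v assume v: "v \<in> dom \<phi>"
    have "the (\<psi> v) < 2" "the (\<phi> v) < 2" "the (\<psi> v) \<noteq> the (\<phi> v)"
      using value_less[of \<psi> v] value_less[of \<phi> v] values_differ[of \<psi> \<phi> v] assms False v by auto
    then show "(-1) ^ the (\<psi> v) = - ((-1 :: int) ^ the (\<phi> v))"
      by (auto simp: less_2_cases_iff)
  qed
  also have "\<dots> = parity (dom \<phi>) (\<lambda>v. the (\<phi> v))"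
    using even_r edge_card[OF dom_edge[OF assms(1)]] by (simp add: prod_uminus parity_def)
  finally show ?thesis .
qed simp

lemma card_edges_gt: "2 ^ (r - 1) < card H"
proof (rule ccontr)
  assume "\<not> ?thesis"
  then have "card H = 2 ^ (r - 1)" using card_edges_ge by simp
  then have "2 ^ r = 2 * card H" using r_pos by (cases r) auto
  then have "card colorings = 2 * card H * 2 ^ (card V - r)" by (simp only: card_colorings)
  then have eq: "(\<Sum>f\<in>colorings. 1) = (\<Sum>f\<in>colorings. hits f)"
    using antisym[OF sum_hits_ge] sum_hits_le by simp
  \<comment> \<open>The two sums agree although every hit count is at least 1: the cylinders form a partition.\<close>
  have one: "hits f = 1" if "f \<in> colorings" for f
    using sum_mono_inv[OF eq hits_pos that fin_colorings] by simp
  obtain \<phi> where \<phi>: "\<phi> \<in> F" using F_nonempty by blast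
  define e where "e = dom \<phi>"
  have e: "e \<in> H" "e \<subseteq> V" using dom_edge dom_subset_V \<phi> by (auto simp: e_def)
  obtain v where v: "v \<in> e" using edge_card[OF e(1)] r_pos by fastforce
  let ?s = "parity e (\<lambda>v. the (\<phi> v))" and ?N = "card {\<psi>\<in>F. dom \<psi> = e}"
  have "0 = (\<Sum>f\<in>colorings. parity e f)"
    unfolding colorings_def using e(2) v by (subst parity_sum_vanishes[of v]) auto
  also have "\<dots> = (\<Sum>f\<in>colorings. parity e f * int (hits f))"
    using one by simp
  also have "\<dots> = (\<Sum>\<psi>\<in>F. \<Sum>f\<in>cylinder \<psi>. parity e f)"
    by (rule weighted_double_count)
  also have "\<dots> = (\<Sum>\<psi>\<in>F. if dom \<psi> = e then ?s * 2 ^ (card V - r) else 0)"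
  proof (rule sum.cong[OF refl])
    fix \<psi> assume "\<psi> \<in> F"
    then show "(\<Sum>f\<in>cylinder \<psi>. parity e f) = (if dom \<psi> = e then ?s * 2 ^ (card V - r) else 0)"
      using parity_of_antipode[OF \<phi>, of \<psi>] parity_sum_cylinder[OF e(1), of \<psi>]
      by (simp add: e_def)
  qed
  also have "\<dots> = int ?N * (?s * 2 ^ (card V - r))"
    by (simp add: fin_F flip: sum.inter_filter)
  finally have "?N = 0 \<or> ?s = 0" by simp
  moreover have "?N \<noteq> 0" using \<phi> fin_F by (auto simp: e_def)
  moreover have "?s \<noteq> 0" using edge_card[OF e(1)] by (simp add: parity_def)
  ultimately show False by blast
qed

end

section \<open>Uncolourable covers from lists of patterns\<close>

text \<open>
  A pattern lists the vertices of an edge with the colour forbidden at each; the second disjunct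
  below is the complementary pattern on the same edge, which a 2-fold cover may forbid as well.
\<close>

definition violates :: "nat list \<Rightarrow> (nat \<times> nat) list \<Rightarrow> bool" where
  "violates xs p \<longleftrightarrow> (\<forall>(v, c)\<in>set p. xs ! v = c) \<or> (\<forall>(v, c)\<in>set p. xs ! v \<noteq> c)"

text \<open>
  Sorting the vertices makes an edge determine its vertex list, so that distinctness of the lists is
  distinctness of the edges; otherwise two patterns on one edge might break the cover condition.
\<close>

definition pattern_system :: "nat \<Rightarrow> nat \<Rightarrow> (nat \<times> nat) list list \<Rightarrow> bool" where
  "pattern_system n r ps \<longleftrightarrow>
     (\<forall>p\<in>set ps. length p = r \<and> sorted_wrt (<) (map fst p) \<and> (\<forall>(v, c)\<in>set p. v < n \<and> c < 2)) \<and>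
     distinct (map (map fst) ps) \<and>
     (\<forall>xs\<in>set (List.n_lists n [0, 1]). \<exists>p\<in>set ps. violates xs p)"

lemma pattern_system_uncolorable:
  assumes "pattern_system n r ps"
  obtains X :: "nat set" and H where "hypergraph X H" "finite H" "uniform r H"
    "\<not> DP_colorable 2 X H" "card H \<le> length ps"
proof -
  have len: "length p = r" and sorted: "sorted_wrt (<) (map fst p)"
    and bound: "\<And>v c. (v, c) \<in> set p \<Longrightarrow> v < n \<and> c < 2" if "p \<in> set ps" for p
    using assms that by (auto simp: pattern_system_def)
  have dist: "distinct (map (map fst) ps)"
    and viol: "\<And>xs. xs \<in> set (List.n_lists n [0, 1]) \<Longrightarrow> \<exists>p\<in>set ps. violates xs p"
    using assms by (auto simp: pattern_system_def)
  have dfst: "distinct (map fst p)" if "p \<in> set ps" for p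
    using sorted[OF that] by (simp add: strict_sorted_iff)
  define edge where "edge p = fst ` set p" for p :: "(nat \<times> nat) list"
  define anti where "anti p = map (\<lambda>(v, c). (v, 1 - c)) p" for p :: "(nat \<times> nat) list"
  define H where "H = edge ` set ps"
  define F where "F = map_of ` set ps \<union> (map_of \<circ> anti) ` set ps"
  have fst_anti: "map fst (anti p) = map fst p" for p
    by (simp add: anti_def comp_def case_prod_beta)
  have edge_anti: "fst ` set (anti p) = edge p" for p
    using arg_cong[OF fst_anti[of p], of set] by (simp add: edge_def)
  have edge_inj: "p = q" if "p \<in> set ps" "q \<in> set ps" "edge p = edge q" for p q
  proof -
    have "map fst p = map fst q"
      using strict_sorted_equal[OF sorted[OF that(2)] sorted[OF that(1)]] that(3)
      by (simp add: edge_def)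
    then show ?thesis using dist that(1,2) by (auto simp: distinct_map dest: inj_onD)
  qed
  have anti_Some: "map_of (anti p) v = Some (1 - c)" if "p \<in> set ps" "(v, c) \<in> set p" for p v c
    using that dfst[OF that(1)] by (intro map_of_is_SomeI) (auto simp: fst_anti, force simp: anti_def)
  have pos_Some: "map_of p v = Some c" if "p \<in> set ps" "(v, c) \<in> set p" for p v c
    using that dfst[OF that(1)] by (intro map_of_is_SomeI) auto
  have graph_disj: "Map.graph (map_of p) \<inter> Map.graph (map_of (anti p)) = {}" if "p \<in> set ps" for p
  proof -
    have False if "map_of p v = Some c" "map_of (anti p) v = Some c" for v c
    proof -
      have "(v, c) \<in> set p" using that(1) by (rule map_of_SomeD)
      then show False using anti_Some[of p v c] bound[of p v c] that(2) \<open>p \<in> set ps\<close>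
        by (auto simp: less_2_cases_iff)
    qed
    then show ?thesis by (auto simp: Map.graph_def)
  qed
  have F_cases: "\<exists>p\<in>set ps. dom \<phi> = edge p \<and> (\<phi> = map_of p \<or> \<phi> = map_of (anti p))"
    if "\<phi> \<in> F" for \<phi>
    using that by (auto simp: F_def dom_map_of_conv_image_fst edge_anti) (auto simp: edge_def)
  have hyp: "hypergraph {..<n} H"
    using bound by (fastforce simp: hypergraph_def H_def edge_def)
  have unif: "uniform r H"
    unfolding uniform_def
  proof
    fix e assume "e \<in> H"
    then obtain p where "p \<in> set ps" "e = set (map fst p)" by (auto simp: H_def edge_def)
    then show "finite e \<and> card e = r"
      using dfst[of p] len[of p] distinct_card[of "map fst p"] by simp
  qed
  have "fold_cover 2 {..<n} H F"
    unfolding fold_cover_def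
  proof (intro conjI ballI impI)
    show "dom ` F \<subseteq> H" using F_cases by (force simp: H_def)
    show "F \<subseteq> partial_maps {..<n} 2"
    proof
      fix \<phi> assume "\<phi> \<in> F"
      then obtain p where p: "p \<in> set ps" "dom \<phi> = edge p" "\<phi> = map_of p \<or> \<phi> = map_of (anti p)"
        using F_cases by blast
      have "c < 2" if "\<phi> v = Some c" for v c
        using p(3)
      proof
        assume "\<phi> = map_of p"
        then show ?thesis using bound[OF p(1)] that map_of_SomeD by metis
      next
        assume "\<phi> = map_of (anti p)"
        then have "(v, c) \<in> set (anti p)" using that by (simp add: map_of_SomeD)
        then show ?thesis by (auto simp: anti_def)
      qed
      then have "ran \<phi> \<subseteq> {..<2}" by (auto simp: ran_def)
      moreover have "dom \<phi> \<subseteq> {..<n}" using p(2) bound[OF p(1)] by (auto simp: edge_def)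
      ultimately show "\<phi> \<in> partial_maps {..<n} 2" by (simp add: partial_maps_def)
    qed
    fix \<phi> \<psi> assume *: "\<phi> \<in> F" "\<psi> \<in> F" "\<phi> \<noteq> \<psi>" "dom \<phi> = dom \<psi>"
    obtain p where p: "p \<in> set ps" "dom \<phi> = edge p" "\<phi> = map_of p \<or> \<phi> = map_of (anti p)"
      using F_cases *(1) by blast
    obtain q where q: "q \<in> set ps" "dom \<psi> = edge q" "\<psi> = map_of q \<or> \<psi> = map_of (anti q)"
      using F_cases *(2) by blast
    have "p = q" using edge_inj p q *(4) by simp
    then show "Map.graph \<phi> \<inter> Map.graph \<psi> = {}"
      using p(3) q(3) *(3) graph_disj[OF p(1)] by auto
  qed
  moreover have "\<not> family_coloring {..<n} 2 F f" for f
  proof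
    assume f: "family_coloring {..<n} 2 F f"
    then have dom: "dom f = {..<n}" and ran: "ran f \<subseteq> {..<2}"
      and avoid: "\<And>\<phi>. \<phi> \<in> F \<Longrightarrow> \<not> \<phi> \<subseteq>\<^sub>m f"
      by (auto simp: family_coloring_def total_maps_def)
    define xs where "xs = map (the \<circ> f) [0..<n]"
    have f_xs: "f v = Some (xs ! v)" if "v < n" for v
    proof -
      have "v \<in> dom f" using that dom by simp
      then show ?thesis using that by (auto simp: xs_def)
    qed
    have lt2: "xs ! v < 2" if "v < n" for v
      using f_xs[OF that] ran by (auto simp: ran_def)
    have length: "length xs = n" by (simp add: xs_def)
    have "set xs \<subseteq> {0, 1}"
    proof
      fix c assume "c \<in> set xs"
      then obtain v where "v < n" "c = xs ! v" unfolding in_set_conv_nth length by blast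
      then show "c \<in> {0, 1}" using lt2[of v] by auto
    qed
    then have "xs \<in> set (List.n_lists n [0, 1])"
      by (simp add: set_n_lists length)
    then obtain p where p: "p \<in> set ps" "violates xs p" using viol by blast
    have inF: "map_of p \<in> F" "map_of (anti p) \<in> F" using p(1) by (auto simp: F_def)
    from p(2) consider "\<forall>(v, c)\<in>set p. xs ! v = c" | "\<forall>(v, c)\<in>set p. xs ! v \<noteq> c"
      by (auto simp: violates_def)
    then show False
    proof cases
      case 1
      have "map_of p \<subseteq>\<^sub>m f"
        unfolding map_le_def
      proof
        fix v assume "v \<in> dom (map_of p)"
        then obtain c where c: "(v, c) \<in> set p" by (auto dest: map_of_SomeD)
        then show "map_of p v = f v"
          using 1 pos_Some[OF p(1) c] f_xs bound[OF p(1) c] by auto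
      qed
      then show False using avoid inF by blast
    next
      case 2
      have "map_of (anti p) \<subseteq>\<^sub>m f"
        unfolding map_le_def
      proof
        fix v assume "v \<in> dom (map_of (anti p))"
        then obtain c where c: "(v, c) \<in> set p"
          by (force simp: anti_def dest: map_of_SomeD)
        have "xs ! v = 1 - c"
          using 2 c lt2[of v] bound[OF p(1) c] by (auto simp: less_2_cases_iff)
        then show "map_of (anti p) v = f v"
          using anti_Some[OF p(1) c] f_xs bound[OF p(1) c] by auto
      qed
      then show False using avoid inF by blast
    qed
  qed
  ultimately have "\<not> DP_colorable 2 {..<n} H" by (auto simp: DP_colorable_def)
  moreover have "card H \<le> length ps"
    using card_image_le[of "set ps" edge] card_length[of ps] by (simp add: H_def)
  ultimately show ?thesis using that hyp unif by (simp add: H_def)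
qed

section \<open>Bounds on the minimum\<close>

text \<open>
  An uncolourable hypergraph has to be supplied, for otherwise the infimum would be 0 by convention
  and no hypergraph would realise it.
\<close>

lemma m_tilde_attained:
  fixes X :: "nat set"
  assumes "hypergraph X H" "finite H" "uniform r H" "\<not> DP_colorable k X H"
  obtains X' :: "nat set" and H' where "hypergraph X' H'" "finite H'" "uniform r H'"
    "\<not> DP_colorable k X' H'" "card H' = m_tilde k r"
proof -
  have "m_tilde k r \<in> {card H | (X :: nat set) H.
     hypergraph X H \<and> finite H \<and> uniform r H \<and> \<not> DP_colorable k X H}"
    unfolding m_tilde_def using assms by (intro Inf_nat_def1) blast
  then show ?thesis using that by force
qed

lemma m_tilde_bounds:
  assumes "pattern_system n r ps" "r \<ge> 1"
  shows "2 ^ (r - 1) \<le> m_tilde 2 r" "even r \<Longrightarrow> 2 ^ (r - 1) < m_tilde 2 r"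
    "m_tilde 2 r \<le> length ps"
proof -
  obtain X :: "nat set" and H where H: "hypergraph X H" "finite H" "uniform r H"
    "\<not> DP_colorable 2 X H" "card H \<le> length ps"
    using pattern_system_uncolorable[OF assms(1)] .
  show "m_tilde 2 r \<le> length ps"
    using m_tilde_le[OF _ H(1-4)] H(5) by simp
  obtain X' :: "nat set" and H' where H': "hypergraph X' H'" "finite H'" "uniform r H'"
    "\<not> DP_colorable 2 X' H'" and card: "card H' = m_tilde 2 r"
    using m_tilde_attained[OF H(1-4)] .
  obtain F where F: "fold_cover 2 X' H' F" "\<And>f. \<not> family_coloring X' 2 F f"
    using H'(4) by (auto simp: DP_colorable_def)
  interpret uncolorable_cover 2 r X' H' F
    using H' F assms(2) by unfold_locales auto
  show "2 ^ (r - 1) \<le> m_tilde 2 r" using card_edges_ge card by simp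
  show "2 ^ (r - 1) < m_tilde 2 r" if "even r"
  proof -
    interpret even_uncolorable_cover r X' H' F
      using that by unfold_locales
    show ?thesis using card_edges_gt card by simp
  qed
qed

text \<open>
  The two systems were found by computer search. On 6 vertices a pattern of size 4 and its complement
  together rule out 8 of the 64 colourings, so ten of them leave some slack. On 8 vertices a pattern
  of size 5 and its complement rule out 16 of the 256 colourings, so 17 edges overlap very little.
\<close>

definition patterns4 :: "(nat \<times> nat) list list" where
  "patterns4 =
    [zip [0, 1, 3, 4] [0, 0, 1, 0],
     zip [0, 1, 4, 5] [0, 1, 0, 0],
     zip [0, 2, 3, 4] [0, 0, 0, 1],
     zip [0, 2, 3, 5] [0, 1, 0, 0],
     zip [0, 2, 4, 5] [0, 1, 1, 1],
     zip [0, 3, 4, 5] [0, 1, 1, 1],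
     zip [1, 2, 3, 5] [0, 0, 0, 0],
     zip [1, 2, 4, 5] [0, 1, 1, 0],
     zip [1, 3, 4, 5] [0, 0, 0, 1],
     zip [2, 3, 4, 5] [0, 1, 1, 0]]"

definition patterns5 :: "(nat \<times> nat) list list" where
  "patterns5 =
    [zip [0, 1, 2, 3, 4] [0, 1, 0, 1, 1],
     zip [0, 1, 2, 3, 5] [0, 0, 1, 0, 1],
     zip [0, 1, 2, 4, 5] [0, 1, 0, 0, 0],
     zip [0, 1, 2, 5, 6] [0, 0, 0, 0, 0],
     zip [0, 1, 2, 5, 7] [0, 1, 1, 1, 0],
     zip [0, 1, 2, 6, 7] [0, 0, 0, 1, 1],
     zip [0, 1, 3, 4, 7] [0, 1, 1, 0, 1],
     zip [0, 1, 3, 5, 7] [0, 1, 0, 1, 1],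
     zip [0, 1, 5, 6, 7] [0, 0, 0, 1, 0],
     zip [0, 2, 3, 4, 7] [0, 1, 1, 1, 1],
     zip [0, 2, 3, 5, 7] [0, 0, 0, 1, 0],
     zip [0, 2, 4, 5, 7] [0, 1, 0, 0, 1],
     zip [0, 2, 5, 6, 7] [0, 1, 0, 0, 0],
     zip [1, 2, 3, 4, 5] [0, 1, 1, 0, 1],
     zip [1, 2, 5, 6, 7] [0, 0, 1, 0, 1],
     zip [1, 3, 4, 5, 7] [0, 1, 1, 1, 0],
     zip [2, 3, 4, 5, 7] [0, 1, 0, 1, 0]]"

lemma pattern_system4: "pattern_system 6 4 patterns4"
  by code_simp

lemma pattern_system5: "pattern_system 8 5 patterns5"
  by code_simp

theorem mainTheorem3:
  "(9 \<le> m_tilde 2 4 \<and> m_tilde 2 4 \<le> 10) \<and> (16 \<le> m_tilde 2 5 \<and> m_tilde 2 5 \<le> 17)"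
  using m_tilde_bounds[OF pattern_system4] m_tilde_bounds[OF pattern_system5]
  by (simp add: patterns4_def patterns5_def)

end
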